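(* Let $\mathcal{X}$ be a separable complete metric space and let $\lambda\in\Lambda^\infty$. If $\lambda\in\Lambda_{\mathsf{LLN}}$ (that is, $\lambda$ satisfies the weighted law of large numbers defined in the context), then $$\sum_{i=1}^\infty\min\{(P\circ\lambda_i)(A),(P\circ\lambda_i)(A^c)\}=\infty$$ for all $P\in\mathcal{M}_{\mathcal{X}}(\lambda)$ and all $A\in\mathcal{B}(\mathcal{X})$ with $P(A)>0$ and $P(A^c)>0$.
   Context: $\mathcal{X}$ is a separable complete metric space with Borel $\sigma$-algebra $\mathcal{B}(\mathcal{X})$. $\Lambda$ is the set of measurable functions $\mathcal{X}\to(0,\infty)$ and $\Lambda^\infty$ is the set of infinite sequences $\lambda=(\lambda_1,\lambda_2,\dots)$ of such functions. $\mathcal{M}_{\mathcal{X}}$ is the set of all (not necessarily finite) measures on $\mathcal{X}$, and $\mathcal{M}_{\mathcal{X}}(\lambda)=\{P\in\mathcal{M}_{\mathcal{X}}: 0<\int_{\mathcal{X}}\lambda_i\,dP<\infty\text{ for all }i\}$. For $P\in\mathcal{M}_{\mathcal{X}}(\lambda)$, $P\circ\lambda_i$ is the probability distribution $(P\circ\lambda_i)(A)=\int_A\lambda_i\,dP\big/\int_{\mathcal{X}}\lambda_i\,dP$ on $\mathcal{X}$, and $P\circ\lambda=(P\circ\lambda_1)\times(P\circ\lambda_2)\times\cdots$ is the product distribution on $\mathcal{X}^\infty$. $\mathcal{S}_n$ is the set of permutations of $\{1,\dots,n\}$. $\Lambda_{\mathsf{LLN}}$ is the set of all $\lambda\in\Lambda^\infty$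 such that for all $P\in\mathcal{M}_{\mathcal{X}}(\lambda)$, $i\ge1$, $A\in\mathcal{B}(\mathcal{X})$, if $X=(X_1,X_2,\dots)\sim P\circ\lambda$ then $\widetilde{P}_{n,i}(A)\to(P\circ\lambda_i)(A)$ almost surely as $n\to\infty$, where for $n\ge i$ $$\widetilde{P}_{n,i}=\sum_{j=1}^n (w_{n,i}(X_1,\dots,X_n))_j\,\delta_{X_j},\qquad (w_{n,i}(x_1,\dots,x_n))_j=\frac{\sum_{\sigma\in\mathcal{S}_n:\sigma(i)=j}\prod_{k=1}^n\lambda_k(x_{\sigma(k)})}{\sum_{\sigma\in\mathcal{S}_n}\prod_{k=1}^n\lambda_k(x_{\sigma(k)})}.$$ *)

theory Defs
  imports "HOL-Probability.Probability" "HOL-Combinatorics.Permutations"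
begin

(* The underlying space is a type of class polish_space, i.e. a complete metric space that is
   second countable (for metric spaces: separable).
   Sequences are indexed from 0: lam i, X i stand for the (i+1)-st weight function and the
   (i+1)-st observation, and permutations of the first n indices are permutations of {..<n}. *)

definition Weight :: "('a::polish_space \<Rightarrow> real) set" where
  "Weight = {f \<in> borel_measurable borel. \<forall>x. 0 < f x}"

definition Weight_seq :: "(nat \<Rightarrow> 'a::polish_space \<Rightarrow> real) set" where
  "Weight_seq = {lam. \<forall>i. lam i \<in> Weight}"

definition Measures :: "(nat \<Rightarrow> 'a::polish_space \<Rightarrow> real) \<Rightarrow> 'a measure set" where
  "Measures lam = {P. sets P = sets borel \<and>
     (\<forall>i. 0 < (\<integral>\<^sup>+ x. ennreal (lam i x) \<partial>P) \<and> (\<integral>\<^sup>+ x. ennreal (lam i x) \<partial>P) < \<infinity>)}"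

definition tilt :: "'a measure \<Rightarrow> ('a \<Rightarrow> real) \<Rightarrow> 'a::polish_space measure" where
  "tilt P f = density P (\<lambda>x. ennreal (f x) / (\<integral>\<^sup>+ y. ennreal (f y) \<partial>P))"

lemma emeasure_tilt:
  assumes "sets P = sets borel" "f \<in> Weight" "A \<in> sets borel"
  shows "emeasure (tilt P f) A =
    (\<integral>\<^sup>+ x\<in>A. ennreal (f x) \<partial>P) / (\<integral>\<^sup>+ x. ennreal (f x) \<partial>P)"
proof -
  have [measurable]: "f \<in> borel_measurable P" "A \<in> sets P"
    using assms by (auto simp: Weight_def cong: measurable_cong_sets)
  show ?thesis
    unfolding tilt_def
    by (subst emeasure_density, simp, simp, subst nn_integral_divide [symmetric])
      (auto intro!: nn_integral_cong simp: divide_ennreal_def mult_ac)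
qed

lemma prob_space_tilt:
  assumes "P \<in> Measures lam" "lam \<in> Weight_seq"
  shows "prob_space (tilt P (lam i))"
proof
  have P: "sets P = sets borel" "space P = UNIV"
    using assms(1) sets_eq_imp_space_eq [of P borel] by (auto simp: Measures_def)
  have "emeasure (tilt P (lam i)) UNIV =
    (\<integral>\<^sup>+ x. ennreal (lam i x) \<partial>P) / (\<integral>\<^sup>+ x. ennreal (lam i x) \<partial>P)"
    using emeasure_tilt [OF P(1), of "lam i" UNIV] assms(2) by (simp add: Weight_seq_def)
  also have "\<dots> = 1"
    using assms(1) by (intro ennreal_divide_self) (auto simp: Measures_def less_top dest!: spec [of _ i])
  finally show "emeasure (tilt P (lam i)) (space (tilt P (lam i))) = 1"
    by (simp add: tilt_def P)
qed

definition tilt_seq ::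
  "'a measure \<Rightarrow> (nat \<Rightarrow> 'a \<Rightarrow> real) \<Rightarrow> (nat \<Rightarrow> 'a::polish_space) measure" where
  "tilt_seq P lam = (\<Pi>\<^sub>M i\<in>UNIV. tilt P (lam i))"

definition weight ::
  "(nat \<Rightarrow> 'a::polish_space \<Rightarrow> real) \<Rightarrow> nat \<Rightarrow> nat \<Rightarrow> (nat \<Rightarrow> 'a) \<Rightarrow> nat \<Rightarrow> real" where
  "weight lam n i x j =
     (\<Sum>\<sigma> | \<sigma> permutes {..<n} \<and> \<sigma> i = j. \<Prod>k<n. lam k (x (\<sigma> k))) /
     (\<Sum>\<sigma> | \<sigma> permutes {..<n}. \<Prod>k<n. lam k (x (\<sigma> k)))"

(* Only meaningful for i < n; return borel (X j) is the Dirac measure at X j. *)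
definition weighted_empirical ::
  "(nat \<Rightarrow> 'a::polish_space \<Rightarrow> real) \<Rightarrow> nat \<Rightarrow> nat \<Rightarrow> (nat \<Rightarrow> 'a) \<Rightarrow> 'a set \<Rightarrow> real" where
  "weighted_empirical lam n i X A =
     (\<Sum>j<n. weight lam n i X j * measure (return borel (X j)) A)"

(* The random sequence X is the coordinate process under its law; the convergence is a property
   of that law alone. *)
definition Weight_LLN :: "(nat \<Rightarrow> 'a::polish_space \<Rightarrow> real) set" where
  "Weight_LLN = {lam \<in> Weight_seq. \<forall>P \<in> Measures lam. \<forall>i. \<forall>A \<in> sets borel.
     AE X in tilt_seq P lam.
       (\<lambda>n. weighted_empirical lam n i X A) \<longlonglongrightarrow> measure (tilt P (lam i)) A}"

end

theory Submission
  imports Defs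
begin

text \<open>
  The weighted empirical measure is a function of the data and the weights only, whereas its limit
  depends on the unknown measure. The law of large numbers therefore cannot hold when two measures
  \<open>P\<close> and \<open>P'\<close> with different limits produce data that cannot be told apart with certainty.

  Suppose that the series converges for some \<open>P\<close> and \<open>A\<close>. Let \<open>E i\<close> be whichever of \<open>A\<close> and \<open>- A\<close>
  has the larger mass under \<open>tilt P (lam i)\<close>. The masses of the complements of the \<open>E i\<close> are summable
  and less than 1, so the box of all \<open>X\<close> with \<open>X i \<in> E i\<close> for every \<open>i\<close> has positive probability
  (\<open>measure_PiM_box_pos\<close>). Let \<open>P'\<close> be \<open>P\<close> with its mass doubled on \<open>A\<close>. Since its density with
  respect to \<open>P\<close> is constant on \<open>A\<close> and on \<open>- A\<close>, conditioning on \<open>E i\<close> gives the same distribution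
  for both measures (\<open>uniform_measure_tilt_density\<close>), and conditioning the product on the box amounts
  to conditioning each factor (\<open>PiM_uniform_measure\<close>). The two laws of the data hence agree once
  conditioned on the box, an event of positive probability under each of them, so some data sequence
  satisfies both laws of large numbers (\<open>AE_PiM_common_point\<close>). But the two limits differ: if \<open>p\<close> is
  the tilted mass of \<open>A\<close> under \<open>P\<close>, then that under \<open>P'\<close> is \<open>2 p / (1 + p)\<close>, which is larger than \<open>p\<close>
  because \<open>0 < p < 1\<close>.
\<close>

section \<open>Conditioning a countable product measure on a box\<close>

lemma sets_PiM_box:
  fixes M :: "nat \<Rightarrow> 'b measure"
  assumes "\<And>i. E i \<in> sets (M i)"
  shows "Pi UNIV E \<in> sets (PiM UNIV M)"
proof -
  have "Pi UNIV E = PiE UNIV E"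
    by auto
  then show ?thesis
    using assms by (auto intro!: sets_PiM_I_countable)
qed

lemma measure_PiM_box_LIMSEQ:
  fixes M :: "nat \<Rightarrow> 'b measure"
  assumes M: "\<And>i. prob_space (M i)" and E: "\<And>i. E i \<in> sets (M i)"
  shows "(\<lambda>n. \<Prod>i<n. measure (M i) (E i)) \<longlonglongrightarrow> measure (PiM UNIV M) (Pi UNIV E)"
proof -
  interpret M: prob_space "M i" for i by (rule M)
  interpret product_prob_space M "UNIV :: nat set"
    by unfold_locales
  let ?E = "\<lambda>n. emb UNIV {..<n} (Pi\<^sub>E {..<n} E)"
  have "(\<Prod>i<n. measure (M i) (E i)) = measure (PiM UNIV M) (?E n)" for n
    using E by (simp add: measure_PiM_emb)
  moreover have "Pi UNIV E = (\<Inter>n. ?E n)"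
    using E E[THEN sets.sets_into_space]
    by (auto simp: prod_emb_def extensional_def Pi_iff) blast
  moreover have "range ?E \<subseteq> sets (PiM UNIV M)"
    using E by auto
  moreover have "decseq ?E"
    by (auto simp: prod_emb_def Pi_iff decseq_def)
  ultimately show ?thesis
    by (simp add: finite_Lim_measure_decseq)
qed

lemma measure_PiM_box_pos:
  fixes M :: "nat \<Rightarrow> 'b measure"
  assumes M: "\<And>i. prob_space (M i)" and E: "\<And>i. E i \<in> sets (M i)"
    and pos: "\<And>i. 0 < measure (M i) (E i)"
    and summable: "summable (\<lambda>i. 1 - measure (M i) (E i))"
  shows "0 < measure (PiM UNIV M) (Pi UNIV E)"
proof -
  have "norm (measure (M i) (E i) - 1) = 1 - measure (M i) (E i)" for i
    using prob_space.prob_le_1[OF M, of i "E i"] by simp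
  then have "convergent_prod (\<lambda>i. measure (M i) (E i))"
    using summable by (intro abs_convergent_prod_imp_convergent_prod
        summable_imp_abs_convergent_prod) simp
  then have has_prod: "(\<lambda>i. measure (M i) (E i)) has_prod (\<Prod>i. measure (M i) (E i))"
    by (rule convergent_prod_has_prod)
  have "(\<lambda>n. \<Prod>i<n. measure (M i) (E i)) \<longlonglongrightarrow> (\<Prod>i. measure (M i) (E i))"
    using has_prod by (rule has_prod_imp_tendsto')
  then have "measure (PiM UNIV M) (Pi UNIV E) = (\<Prod>i. measure (M i) (E i))"
    using measure_PiM_box_LIMSEQ[of M E] M E by (blast intro: LIMSEQ_unique)
  then show ?thesis
    using has_prod_pos[OF has_prod pos] by simp
qed

text \<open>\<open>uniform_measure M E\<close> is \<open>M\<close> conditioned on \<open>E\<close>.\<close>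

lemma PiM_uniform_measure:
  fixes M :: "nat \<Rightarrow> 'b measure"
  assumes M: "\<And>i. prob_space (M i)" and E: "\<And>i. E i \<in> sets (M i)"
    and box_pos: "0 < measure (PiM UNIV M) (Pi UNIV E)"
    and pos: "\<And>i. 0 < measure (M i) (E i)"
  shows "PiM UNIV (\<lambda>i. uniform_measure (M i) (E i)) = uniform_measure (PiM UNIV M) (Pi UNIV E)"
proof -
  interpret M: prob_space "M i" for i by (rule M)
  interpret PM: prob_space "PiM UNIV M" by (intro prob_space_PiM M)
  define U where "U i = uniform_measure (M i) (E i)" for i
  have U: "prob_space (U i)" for i
    unfolding U_def using pos[of i] by (intro prob_space_uniform_measure) (auto simp: M.emeasure_eq_measure)
  interpret U: prob_space "U i" for i by (rule U)
  interpret product_prob_space U "UNIV :: nat set"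
    by unfold_locales
  have sets_U: "sets (U i) = sets (M i)" for i by (simp add: U_def)
  have space_U: "space (U i) = space (M i)" for i by (simp add: U_def)
  have sets_PiM_U: "sets (PiM UNIV U) = sets (PiM UNIV M)"
    by (intro sets_PiM_cong) (auto simp: sets_U)
  have emb_U: "prod_emb UNIV U J X = prod_emb UNIV M J X" for J X
    by (simp add: prod_emb_def space_U)
  have box: "Pi UNIV E \<in> sets (PiM UNIV M)"
    by (rule sets_PiM_box) fact
  have "uniform_measure (PiM UNIV M) (Pi UNIV E) = PiM UNIV U"
  proof (rule PiM_eq)
    show "sets (uniform_measure (PiM UNIV M) (Pi UNIV E)) = sets (PiM UNIV U)"
      by (simp add: sets_PiM_U)
    fix J :: "nat set" and F
    assume J: "finite J" and F: "\<And>j. j \<in> J \<Longrightarrow> F j \<in> sets (U j)"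
    define G where "G j = (if j \<in> J then E j \<inter> F j else E j)" for j
    have G: "G j \<in> sets (M j)" for j
      using E F by (auto simp: G_def sets_U)
    let ?X = "prod_emb UNIV M J (Pi\<^sub>E J F)"
    have X: "?X \<in> sets (PiM UNIV M)"
      using J F by (intro sets_PiM_I) (auto simp: sets_U)
    have box_Int: "Pi UNIV E \<inter> ?X = Pi UNIV G"
    proof (intro set_eqI iffI)
      fix x assume "x \<in> Pi UNIV E \<inter> ?X"
      then show "x \<in> Pi UNIV G"
        by (auto simp: prod_emb_def G_def PiE_iff)
    next
      fix x assume "x \<in> Pi UNIV G"
      then have "x i \<in> E i" "i \<in> J \<Longrightarrow> x i \<in> F i" for i
        by (auto simp: G_def Pi_iff split: if_splits)
      then show "x \<in> Pi UNIV E \<inter> ?X"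
        using E[THEN sets.sets_into_space] by (auto simp: prod_emb_def PiE_iff)
    qed
    let ?c = "measure (PiM UNIV M) (Pi UNIV E)"
    let ?r = "\<Prod>j\<in>J. measure (U j) (F j)"
    have G_eq: "measure (M i) (G i) = measure (M i) (E i) * (if i \<in> J then measure (U i) (F i) else 1)" for i
      using pos[of i] F[of i] E
      by (auto simp: G_def U_def M.emeasure_eq_measure)
    obtain N where N: "J \<subseteq> {..<N}"
      using J finite_nat_iff_bounded by blast
    \<comment> \<open>Only the finitely many factors with index in J differ, so that the partial products of the
      smaller box are those of the large one times a constant from some index on.\<close>
    have "eventually (\<lambda>n. (\<Prod>i<n. measure (M i) (G i)) = (\<Prod>i<n. measure (M i) (E i)) * ?r) sequentially"
      using eventually_ge_at_top[of N]
    proof eventually_elim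
      case (elim n)
      then have "{..<n} \<inter> J = J"
        using N by auto
      then have "(\<Prod>i<n. if i \<in> J then measure (U i) (F i) else 1) = ?r"
        using prod.inter_restrict[of "{..<n}" "\<lambda>i. measure (U i) (F i)" J] by (simp only: finite_lessThan)
      then show ?case
        by (simp add: G_eq prod.distrib)
    qed
    moreover have "(\<lambda>n. (\<Prod>i<n. measure (M i) (E i)) * ?r) \<longlonglongrightarrow> ?c * ?r"
      by (intro tendsto_mult_right measure_PiM_box_LIMSEQ M E)
    ultimately have "(\<lambda>n. \<Prod>i<n. measure (M i) (G i)) \<longlonglongrightarrow> ?c * ?r"
      by (simp add: tendsto_cong)
    then have "measure (PiM UNIV M) (Pi UNIV G) = ?c * ?r"
      using measure_PiM_box_LIMSEQ[of M G] M G by (blast intro: LIMSEQ_unique)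
    then have "measure (uniform_measure (PiM UNIV M) (Pi UNIV E)) ?X = ?r"
      using box_pos X by (simp add: PM.emeasure_eq_measure box_Int)
    moreover have "prob_space (uniform_measure (PiM UNIV M) (Pi UNIV E))"
      using box_pos by (intro prob_space_uniform_measure) (auto simp: PM.emeasure_eq_measure)
    ultimately have "emeasure (uniform_measure (PiM UNIV M) (Pi UNIV E)) ?X = ennreal ?r"
      by (simp add: finite_measure.emeasure_eq_measure prob_space_def)
    then show "emeasure (uniform_measure (PiM UNIV M) (Pi UNIV E)) (prod_emb UNIV U J (Pi\<^sub>E J F))
        = (\<Prod>j\<in>J. emeasure (U j) (F j))"
      by (simp add: emb_U U.emeasure_eq_measure prod_ennreal)
  qed
  then show ?thesis
    by (simp add: U_def[abs_def])
qed

text \<open>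
  Two product measures whose factors agree when conditioned on the \<open>E i\<close> are not mutually singular
  if the box has positive probability under both: the common conditioned product is absolutely
  continuous with respect to each of them.
\<close>

lemma AE_PiM_common_point:
  fixes M N :: "nat \<Rightarrow> 'b measure"
  assumes M: "\<And>i. prob_space (M i)" and N: "\<And>i. prob_space (N i)"
    and E: "\<And>i. E i \<in> sets (M i)" "\<And>i. E i \<in> sets (N i)"
    and pos: "\<And>i. 0 < measure (M i) (E i)" "\<And>i. 0 < measure (N i) (E i)"
    and summable: "summable (\<lambda>i. 1 - measure (M i) (E i))" "summable (\<lambda>i. 1 - measure (N i) (E i))"
    and eq: "\<And>i. uniform_measure (M i) (E i) = uniform_measure (N i) (E i)"
    and AE: "AE x in PiM UNIV M. Q x" "AE x in PiM UNIV N. R x"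
  shows "\<exists>x. Q x \<and> R x"
proof -
  let ?U = "PiM UNIV (\<lambda>i. uniform_measure (M i) (E i))"
  have U: "prob_space ?U"
  proof (intro prob_space_PiM prob_space_uniform_measure)
    fix i
    show "emeasure (M i) (E i) \<noteq> 0" "emeasure (M i) (E i) \<noteq> \<infinity>"
      using pos(1)[of i] M[of i]
      by (auto simp: finite_measure.emeasure_eq_measure prob_space.finite_measure)
  qed
  have U_M: "?U = uniform_measure (PiM UNIV M) (Pi UNIV E)"
    by (intro PiM_uniform_measure measure_PiM_box_pos M E pos summable)
  have U_N: "?U = uniform_measure (PiM UNIV N) (Pi UNIV E)"
    unfolding eq by (intro PiM_uniform_measure measure_PiM_box_pos N E pos summable)
  have "AE x in ?U. Q x"
    unfolding U_M using AE(1) by (intro AE_uniform_measureI sets_PiM_box E) auto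
  moreover have "AE x in ?U. R x"
    unfolding U_N using AE(2) by (intro AE_uniform_measureI sets_PiM_box E) auto
  ultimately have "AE x in ?U. \<exists>x. Q x \<and> R x"
    by eventually_elim blast
  then show ?thesis
    by (simp add: prob_space.AE_const[OF U])
qed

section \<open>Tilting a reweighted measure\<close>

lemma sets_tilt [simp]: "sets (tilt P f) = sets P"
  by (simp add: tilt_def)

text \<open>
  Reweighting by a density that is constant on \<open>E\<close> does not change the tilted distribution
  conditioned on \<open>E\<close>; both the constant and the normalisations cancel.
\<close>

lemma uniform_measure_tilt_density:
  fixes P :: "'a::polish_space measure"
  assumes P: "P \<in> Measures lam" and P': "density P g \<in> Measures lam" and lam: "lam \<in> Weight_seq"
    and g: "g \<in> borel_measurable P" and E: "E \<in> sets P"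
    and g_eq: "\<And>x. x \<in> E \<Longrightarrow> g x = c" and c: "c \<noteq> 0" "c \<noteq> \<infinity>"
  shows "uniform_measure (tilt (density P g) (lam i)) E = uniform_measure (tilt P (lam i)) E"
proof (rule measure_eqI)
  fix B assume "B \<in> sets (uniform_measure (tilt (density P g) (lam i)) E)"
  then have B: "B \<in> sets P"
    by simp
  have sets_P: "sets P = sets borel"
    using P by (simp add: Measures_def)
  let ?f = "\<lambda>x. ennreal (lam i x)"
  have f: "lam i \<in> Weight"
    using lam by (simp add: Weight_seq_def)
  have [measurable]: "lam i \<in> borel_measurable P" "g \<in> borel_measurable P"
    using f g sets_P by (auto simp: Weight_def cong: measurable_cong_sets)
  let ?u = "\<lambda>C. \<integral>\<^sup>+ x\<in>C. ?f x \<partial>P"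
  have scale: "(\<integral>\<^sup>+ x\<in>C. ?f x \<partial>density P g) = c * ?u C" if "C \<subseteq> E" "C \<in> sets P" for C
  proof -
    have [measurable]: "C \<in> sets P" by fact
    have "(\<integral>\<^sup>+ x\<in>C. ?f x \<partial>density P g) = (\<integral>\<^sup>+ x. g x * (?f x * indicator C x) \<partial>P)"
      by (subst nn_integral_density) auto
    also have "\<dots> = (\<integral>\<^sup>+ x. c * (?f x * indicator C x) \<partial>P)"
      using that g_eq by (intro nn_integral_cong) (auto split: split_indicator)
    finally show ?thesis
      by (simp add: nn_integral_cmult)
  qed
  have cancel: "(x / U) / (y / U) = x / y" if "U \<noteq> 0" "U \<noteq> \<infinity>" for x y U :: ennreal
    unfolding divide_ennreal_def[of _ U] using that
    by (intro divide_mult_eq) (auto simp: ennreal_inverse_eq_0_iff)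
  have uniform: "emeasure (uniform_measure (tilt Q (lam i)) E) B
      = (\<integral>\<^sup>+ x\<in>E \<inter> B. ?f x \<partial>Q) / (\<integral>\<^sup>+ x\<in>E. ?f x \<partial>Q)"
    if Q: "Q \<in> Measures lam" for Q
  proof -
    have "sets Q = sets borel" "(\<integral>\<^sup>+ x. ?f x \<partial>Q) \<noteq> 0" "(\<integral>\<^sup>+ x. ?f x \<partial>Q) \<noteq> \<infinity>"
      using Q by (auto simp: Measures_def less_top zero_less_iff_neq_zero)
    with sets_P B E f show ?thesis
      by (subst emeasure_uniform_measure) (simp_all add: emeasure_tilt cancel)
  qed
  have "emeasure (uniform_measure (tilt (density P g) (lam i)) E) B = (c * ?u (E \<inter> B)) / (c * ?u E)"
    using B E by (simp add: uniform[OF P'] scale)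
  also have "\<dots> = ?u (E \<inter> B) / ?u E"
    unfolding mult.commute[of c] using c by (intro divide_mult_eq) auto
  finally show "emeasure (uniform_measure (tilt (density P g) (lam i)) E) B
      = emeasure (uniform_measure (tilt P (lam i)) E) B"
    by (simp add: uniform[OF P])
qed simp

text \<open>
  The measure with the mass of \<open>P\<close> doubled on \<open>A\<close> and unchanged elsewhere. Any factor other than 1,
  0 and \<open>\<infinity>\<close> would do as well.
\<close>

definition double_on :: "'a set \<Rightarrow> 'a measure \<Rightarrow> 'a measure" where
  "double_on A P = density P (\<lambda>x. if x \<in> A then 2 else 1)"

lemma nn_integral_double_on:
  assumes [measurable]: "A \<in> sets P" "f \<in> borel_measurable P"
  shows "(\<integral>\<^sup>+ x. f x \<partial>double_on A P) = (\<integral>\<^sup>+ x. f x \<partial>P) + (\<integral>\<^sup>+ x\<in>A. f x \<partial>P)"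
proof -
  have "(\<integral>\<^sup>+ x. f x \<partial>double_on A P) = (\<integral>\<^sup>+ x. f x + f x * indicator A x \<partial>P)"
    unfolding double_on_def
    by (subst nn_integral_density) (auto intro!: nn_integral_cong simp: mult_2 split: split_indicator)
  also have "\<dots> = (\<integral>\<^sup>+ x. f x \<partial>P) + (\<integral>\<^sup>+ x\<in>A. f x \<partial>P)"
    by (rule nn_integral_add) auto
  finally show ?thesis .
qed

lemma double_on_in_Measures:
  assumes P: "P \<in> Measures lam" and lam: "lam \<in> Weight_seq" and A: "A \<in> sets borel"
  shows "double_on A P \<in> Measures lam"
proof -
  have sets_P: "sets P = sets borel"
    using P by (simp add: Measures_def)
  have [measurable]: "lam i \<in> borel_measurable P" for i
    using lam sets_P by (auto simp: Weight_seq_def Weight_def cong: measurable_cong_sets)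
  have A': "A \<in> sets P"
    using A sets_P by simp
  have "(\<integral>\<^sup>+ x\<in>A. ennreal (lam i x) \<partial>P) \<le> (\<integral>\<^sup>+ x. ennreal (lam i x) \<partial>P)" for i
    by (intro nn_integral_mono) (auto split: split_indicator)
  moreover have "0 < (\<integral>\<^sup>+ x. ennreal (lam i x) \<partial>P) \<and> (\<integral>\<^sup>+ x. ennreal (lam i x) \<partial>P) < \<infinity>" for i
    using P by (simp add: Measures_def)
  ultimately have "0 < (\<integral>\<^sup>+ x. ennreal (lam i x) \<partial>double_on A P)
      \<and> (\<integral>\<^sup>+ x. ennreal (lam i x) \<partial>double_on A P) < \<infinity>" for i
    by (auto simp: nn_integral_double_on A' add_pos_nonneg intro: le_less_trans)
  then show ?thesis
    by (simp add: Measures_def) (simp add: double_on_def sets_P)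
qed

lemma measure_tilt_double_on:
  assumes P: "P \<in> Measures lam" and lam: "lam \<in> Weight_seq" and A: "A \<in> sets borel"
  shows "measure (tilt (double_on A P) (lam i)) A
    = 2 * measure (tilt P (lam i)) A / (1 + measure (tilt P (lam i)) A)"
proof -
  have sets_P: "sets P = sets borel"
    using P by (simp add: Measures_def)
  have [measurable]: "lam i \<in> borel_measurable P"
    using lam sets_P by (auto simp: Weight_seq_def Weight_def cong: measurable_cong_sets)
  have [measurable]: "A \<in> sets P"
    using A sets_P by simp
  let ?f = "\<lambda>x. ennreal (lam i x)"
  have total: "0 < (\<integral>\<^sup>+ x. ?f x \<partial>P)" "(\<integral>\<^sup>+ x. ?f x \<partial>P) < \<infinity>"
    using P by (auto simp: Measures_def)
  have le: "(\<integral>\<^sup>+ x\<in>A. ?f x \<partial>P) \<le> (\<integral>\<^sup>+ x. ?f x \<partial>P)"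
    by (intro nn_integral_mono) (auto split: split_indicator)
  obtain t where t: "(\<integral>\<^sup>+ x. ?f x \<partial>P) = ennreal t" "0 < t"
    using total by (cases "\<integral>\<^sup>+ x. ?f x \<partial>P") auto
  obtain a where a: "(\<integral>\<^sup>+ x\<in>A. ?f x \<partial>P) = ennreal a" "0 \<le> a"
    using le t by (cases "\<integral>\<^sup>+ x\<in>A. ?f x \<partial>P") (auto simp: top_unique)
  have f: "lam i \<in> Weight"
    using lam by (simp add: Weight_seq_def)
  have "emeasure (tilt P (lam i)) A = ennreal (a / t)"
    using t a by (simp add: emeasure_tilt sets_P f A divide_ennreal)
  then have p: "measure (tilt P (lam i)) A = a / t"
    using t a by (simp add: measure_def)
  have "(\<integral>\<^sup>+ x. ?f x \<partial>double_on A P) = ennreal (t + a)"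
    using t a by (simp add: nn_integral_double_on)
  moreover have "(\<integral>\<^sup>+ x\<in>A. ?f x \<partial>double_on A P) = ennreal (2 * a)"
  proof -
    have "(\<integral>\<^sup>+ x. ?f x * indicator A x * indicator A x \<partial>P) = (\<integral>\<^sup>+ x\<in>A. ?f x \<partial>P)"
      by (intro nn_integral_cong) (auto split: split_indicator)
    then show ?thesis
      using a by (simp add: nn_integral_double_on flip: ennreal_plus)
  qed
  moreover have "sets (double_on A P) = sets borel"
    by (simp add: double_on_def sets_P)
  ultimately have "emeasure (tilt (double_on A P) (lam i)) A = ennreal (2 * a / (t + a))"
    using t a by (simp add: emeasure_tilt f A divide_ennreal del: ennreal_plus)
  then have "measure (tilt (double_on A P) (lam i)) A = 2 * a / (t + a)"
    using t a by (simp add: measure_def)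
  also have "\<dots> = 2 * (a / t) / (1 + a / t)"
    using t a by (simp add: field_simps)
  finally show ?thesis
    by (simp add: p)
qed

lemma measure_tilt_pos:
  fixes P :: "'a::polish_space measure"
  assumes P: "P \<in> Measures lam" and lam: "lam \<in> Weight_seq" and A: "A \<in> sets borel"
    and pos: "0 < emeasure P A"
  shows "0 < measure (tilt P (lam i)) A"
proof -
  have sets_P: "sets P = sets borel"
    using P by (simp add: Measures_def)
  have [measurable]: "lam i \<in> borel_measurable P"
    using lam sets_P by (auto simp: Weight_seq_def Weight_def cong: measurable_cong_sets)
  have [measurable]: "A \<in> sets P"
    using A sets_P by simp
  interpret prob_space "tilt P (lam i)"
    by (rule prob_space_tilt) fact+
  have f: "lam i \<in> Weight" and f_pos: "\<And>x. 0 < lam i x"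
    using lam by (auto simp: Weight_seq_def Weight_def)
  have "(\<integral>\<^sup>+ x\<in>A. ennreal (lam i x) \<partial>P) \<noteq> 0"
  proof
    assume "(\<integral>\<^sup>+ x\<in>A. ennreal (lam i x) \<partial>P) = 0"
    then have "AE x in P. ennreal (lam i x) * indicator A x = 0"
      by (subst (asm) nn_integral_0_iff_AE) auto
    then have "AE x in P. x \<notin> A"
    proof eventually_elim
      case (elim x)
      then show ?case
        using f_pos[of x] by (auto simp: ennreal_eq_0_iff not_le)
    qed
    then have "emeasure P A = 0"
      using AE_iff_measurable[of A P "\<lambda>x. x \<notin> A"] sets_eq_imp_space_eq[OF sets_P] by simp
    with pos show False by simp
  qed
  moreover have "(\<integral>\<^sup>+ x. ennreal (lam i x) \<partial>P) \<noteq> \<infinity>"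
    using P by (simp add: Measures_def less_top)
  ultimately have "emeasure (tilt P (lam i)) A \<noteq> 0"
    by (simp add: emeasure_tilt sets_P f A ennreal_divide_eq_0_iff)
  then show ?thesis
    by (simp add: emeasure_eq_measure zero_less_measure_iff)
qed

section \<open>Divergence of the minority masses\<close>

theorem theorem5:
  fixes lam :: "nat \<Rightarrow> 'a::polish_space \<Rightarrow> real"
  assumes "lam \<in> Weight_seq"
    and "lam \<in> Weight_LLN"
  shows "\<forall>P \<in> Measures lam. \<forall>A \<in> sets borel.
    0 < emeasure P A \<longrightarrow> 0 < emeasure P (- A) \<longrightarrow>
    (\<Sum>i. min (emeasure (tilt P (lam i)) A) (emeasure (tilt P (lam i)) (- A))) = \<infinity>"
proof (intro ballI impI, rule ccontr)
  fix P and A :: "'a set"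
  assume P: "P \<in> Measures lam" and A: "A \<in> sets borel"
    and A_pos: "0 < emeasure P A" and cA_pos: "0 < emeasure P (- A)"
    and fin: "(\<Sum>i. min (emeasure (tilt P (lam i)) A) (emeasure (tilt P (lam i)) (- A))) \<noteq> \<infinity>"
  define P' where "P' = double_on A P"
  define M where "M i = tilt P (lam i)" for i
  define M' where "M' i = tilt P' (lam i)" for i
  have P': "P' \<in> Measures lam"
    unfolding P'_def by (rule double_on_in_Measures) fact+
  interpret M: prob_space "M i" for i
    unfolding M_def by (rule prob_space_tilt) fact+
  interpret M': prob_space "M' i" for i
    unfolding M'_def by (rule prob_space_tilt) fact+
  have sets_P: "sets P = sets borel" "sets P' = sets borel"
    using P P' by (auto simp: Measures_def)
  have sets_M [simp]: "sets (M i) = sets borel" "sets (M' i) = sets borel" for i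
    by (simp_all add: M_def M'_def sets_P)
  have space_M [simp]: "space (M i) = UNIV" "space (M' i) = UNIV" for i
    using sets_M[THEN sets_eq_imp_space_eq] by simp_all
  define p where "p i = measure (M i) A" for i
  define p' where "p' i = measure (M' i) A" for i
  have compl: "measure (M i) (- A) = 1 - p i" "measure (M' i) (- A) = 1 - p' i" for i
    using M.prob_compl[of A i] M'.prob_compl[of A i] A
    by (simp_all add: p_def p'_def Compl_eq_Diff_UNIV)
  have p: "0 < p i" "p i < 1" for i
  proof -
    show "0 < p i"
      unfolding p_def M_def by (rule measure_tilt_pos) fact+
    have "0 < measure (M i) (- A)"
      unfolding M_def using A cA_pos by (intro measure_tilt_pos[OF P assms(1)]) auto
    then show "p i < 1"
      by (simp add: compl)
  qed
  have p': "p' i = 2 * p i / (1 + p i)" for i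
    unfolding p'_def p_def M_def M'_def P'_def by (rule measure_tilt_double_on) fact+
  have p'_bounds: "0 < p' i" "p' i < 1" "p' i \<le> 2 * p i" "1 - p' i \<le> 1 - p i" for i
    using p[of i] by (auto simp: p' field_simps)

  have "min (emeasure (M i) A) (emeasure (M i) (- A)) = ennreal (min (p i) (1 - p i))" for i
    using p[of i] by (simp add: M.emeasure_eq_measure compl p_def min_def)
  then have summable_min: "summable (\<lambda>i. min (p i) (1 - p i))"
    using fin p by (intro summable_suminf_not_top) (auto simp: M_def less_imp_le)

  \<comment> \<open>The set of larger mass is chosen by \<open>P\<close> alone; it serves for \<open>P'\<close> as well, because doubling
    the mass on \<open>A\<close> multiplies the mass of either set by at most 2.\<close>
  define E where "E i = (if p i \<le> 1 - p i then - A else A)" for i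
  have E: "E i \<in> sets borel" for i
    using A by (simp add: E_def)
  have E_M: "1 - measure (M i) (E i) = min (p i) (1 - p i)" for i
    by (simp add: E_def compl flip: p_def)
  have E_M': "1 - measure (M' i) (E i) \<le> 2 * min (p i) (1 - p i)" for i
    using p'_bounds[of i] p[of i] by (simp add: E_def compl flip: p'_def)
  have summable_M': "summable (\<lambda>i. 1 - measure (M' i) (E i))"
    by (rule summable_comparison_test'[OF summable_mult[OF summable_min, of 2]]) (use E_M' in simp)
  have [measurable]: "A \<in> sets P"
    using A sets_P by simp
  have uniform_eq: "uniform_measure (M i) (E i) = uniform_measure (M' i) (E i)" for i
    unfolding M_def M'_def P'_def double_on_def using P' A
    by (intro uniform_measure_tilt_density[symmetric, OF P _ assms(1),
          where c = "if p i \<le> 1 - p i then 1 else 2"])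
      (measurable, auto simp: E_def sets_P P'_def double_on_def split: if_splits)

  \<comment> \<open>The law of large numbers at the single index 0 suffices.\<close>
  let ?W = "\<lambda>X n. weighted_empirical lam n 0 X A"
  have "AE X in PiM UNIV M. ?W X \<longlonglongrightarrow> p 0" "AE X in PiM UNIV M'. ?W X \<longlonglongrightarrow> p' 0"
    using assms(2) P P' A unfolding Weight_LLN_def tilt_seq_def p_def p'_def M_def M'_def by blast+
  moreover have "0 < measure (M i) (E i)" "0 < measure (M' i) (E i)" for i
    using p[of i] p'_bounds[of i] by (simp_all add: E_def compl flip: p_def p'_def)
  moreover have "summable (\<lambda>i. 1 - measure (M i) (E i))"
    using summable_min by (simp add: E_M)
  ultimately obtain X where "?W X \<longlonglongrightarrow> p 0" "?W X \<longlonglongrightarrow> p' 0"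
    using AE_PiM_common_point[of M M' E "\<lambda>X. ?W X \<longlonglongrightarrow> p 0" "\<lambda>X. ?W X \<longlonglongrightarrow> p' 0"]
      M.prob_space_axioms M'.prob_space_axioms E uniform_eq summable_M'
    by auto
  then have "p 0 = p' 0"
    by (rule LIMSEQ_unique)
  moreover have "p 0 < p' 0"
    using p[of 0] by (simp add: p' field_simps)
  ultimately show False
    by simp
qed

end
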